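(* Let $B\subset\mathbb R^2$ be the unit disc and let $D\subset\mathbb R^2$ be a bounded simply connected domain with infinite geodesic diameter. Then for every $\varepsilon>0$ there does not exist a conformal mapping $\varphi$ of $B$ onto $D$ with $\varphi\in L^1_{2+\varepsilon}(B)$.
   Context: A mapping $\varphi:B\to\mathbb R^2$ belongs to $L^1_p(B)$ if its coordinate functions are locally summable and weakly differentiable with weak gradients in $L_p(B)$. The geodesic diameter of a domain $D$ is the supremum over $x,y\in D$ of the intrinsic geodesic distance between $x$ and $y$ in $D$ (the infimum of lengths of curves in $D$ joining $x$ and $y$). *)

theory Defs
  imports "HOL-Complex_Analysis.Complex_Analysis"
begin

section \<open>Sobolev spaces \<open>L\<^sup>1\<^sub>p\<close>\<close>

primrec times_continuously_differentiable ::
    "nat \<Rightarrow> ('a::euclidean_space \<Rightarrow> real) \<Rightarrow> bool" where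
  "times_continuously_differentiable 0 f \<longleftrightarrow> continuous_on UNIV f"
| "times_continuously_differentiable (Suc k) f \<longleftrightarrow>
     f differentiable_on UNIV \<and>
     (\<forall>i\<in>Basis. times_continuously_differentiable k (\<lambda>x. frechet_derivative f (at x) i))"

definition test_functions :: "'a::euclidean_space set \<Rightarrow> ('a \<Rightarrow> real) set" where
  "test_functions U =
     {\<psi>. (\<forall>k. times_continuously_differentiable k \<psi>) \<and>
         compact (closure {x. \<psi> x \<noteq> 0}) \<and> closure {x. \<psi> x \<noteq> 0} \<subseteq> U}"

definition locally_summable_on ::
    "('a::euclidean_space \<Rightarrow> 'b::euclidean_space) \<Rightarrow> 'a set \<Rightarrow> bool"
    (infixr \<open>locally'_summable'_on\<close> 46) where
  "f locally_summable_on U \<longleftrightarrow> (\<forall>K. compact K \<and> K \<subseteq> U \<longrightarrow> f absolutely_integrable_on K)"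

definition has_weak_gradient_on ::
    "('a::euclidean_space \<Rightarrow> real) \<Rightarrow> ('a \<Rightarrow> 'a) \<Rightarrow> 'a set \<Rightarrow> bool" where
  "has_weak_gradient_on f v U \<longleftrightarrow>
     v locally_summable_on U \<and>
     (\<forall>\<psi>\<in>test_functions U. \<forall>i\<in>Basis.
        (LINT x:U|lebesgue. f x * frechet_derivative \<psi> (at x) i) =
        - (LINT x:U|lebesgue. (v x \<bullet> i) * \<psi> x))"

definition Lp_space ::
    "real \<Rightarrow> 'a::euclidean_space set \<Rightarrow> ('a \<Rightarrow> 'b::euclidean_space) set" where
  "Lp_space p U =
     {v. v \<in> borel_measurable (lebesgue_on U) \<and>
         integrable (lebesgue_on U) (\<lambda>x. norm (v x) powr p)}"

text \<open>The coordinate functions of a map \<open>\<phi>\<close> are \<open>\<lambda>x. \<phi> x \<bullet> j\<close> for \<open>j \<in> Basis\<close>;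
  for values in \<^typ>\<open>complex\<close> these are the real and the imaginary part.\<close>

definition L1p_space ::
    "real \<Rightarrow> 'a::euclidean_space set \<Rightarrow> ('a \<Rightarrow> 'b::euclidean_space) set" where
  "L1p_space p U =
     {\<phi>. \<forall>j\<in>Basis. (\<lambda>x. \<phi> x \<bullet> j) locally_summable_on U \<and>
            (\<exists>v. has_weak_gradient_on (\<lambda>x. \<phi> x \<bullet> j) v U \<and> v \<in> Lp_space p U)}"


section \<open>Geodesic diameter\<close>

text \<open>The length is the supremum over all partitions
  \<open>0 = t 0 \<le> t 1 \<le> \<dots> \<le> t n = 1\<close>; it is \<open>\<infinity>\<close> for non-rectifiable paths.\<close>

definition path_length :: "(real \<Rightarrow> 'a::metric_space) \<Rightarrow> ennreal" where
  "path_length g =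
     (SUP (n, t) \<in> {(n::nat, t::nat \<Rightarrow> real). mono_on {..n} t \<and> t 0 = 0 \<and> t n = 1}.
        \<Sum>k<n. ennreal (dist (g (t k)) (g (t (Suc k)))))"

definition geodesic_distance :: "'a::metric_space set \<Rightarrow> 'a \<Rightarrow> 'a \<Rightarrow> ennreal" where
  "geodesic_distance D x y =
     (INF g \<in> {g. path g \<and> path_image g \<subseteq> D \<and> pathstart g = x \<and> pathfinish g = y}.
        path_length g)"

definition geodesic_diameter :: "'a::metric_space set \<Rightarrow> ennreal" where
  "geodesic_diameter D = (SUP x\<in>D. SUP y\<in>D. geodesic_distance D x y)"


section \<open>Conformal mappings of plane domains\<close>

text \<open>The plane is identified with \<^typ>\<open>complex\<close>. A conformal mapping onto \<open>D\<close> is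
  biholomorphic; holomorphy of the inverse is automatic for injective holomorphic maps on open sets.\<close>

definition conformal_map_onto ::
    "(complex \<Rightarrow> complex) \<Rightarrow> complex set \<Rightarrow> complex set \<Rightarrow> bool" where
  "conformal_map_onto \<phi> U D \<longleftrightarrow> \<phi> holomorphic_on U \<and> inj_on \<phi> U \<and> \<phi> ` U = D"

end

theory Submission
  imports Defs
begin

text \<open>
  Testing the weak gradient of \<open>\<phi> \<in> L\<^sup>1\<^sub>p\<close> against a radial bump on a disc of radius \<open>r\<close> around \<open>w\<close>
  produces a multiple of \<open>\<phi>' w\<close> (mean value property), and an elementary form of
  Hoelder's inequality then gives \<open>\<bar>\<phi>' w\<bar> \<le> C r powr (-2/p)\<close>. For \<open>p > 2\<close> the function
  \<open>(1 - \<bar>w\<bar>) powr (-2/p)\<close> is integrable along radii, so all radii have images of uniformly bounded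
  length, and any two points of the image are joined through \<open>\<phi> 0\<close> by a curve of bounded length.
\<close>

section \<open>Smooth bump functions\<close>

text \<open>The classical flat function \<open>exp (- (1 / t))\<close>, divided by
  \<open>t ^ k\<close>. The whole family over \<open>k\<close> is carried along because derivatives
  of its members are linear combinations of members.\<close>

definition flat_exp :: "nat \<Rightarrow> real \<Rightarrow> real" where
  "flat_exp k t = (if t > 0 then exp (- (1 / t)) / t ^ k else 0)"

lemma flat_exp_nonneg: "flat_exp k t \<ge> 0"
  by (simp add: flat_exp_def)

text \<open>The substitution \<open>x = 1 / t\<close> turns the limit from the right into that of
  \<open>x ^ k / exp x\<close> at infinity; on the left the function is zero.\<close>

lemma flat_exp_tendsto_0: "(flat_exp k \<longlongrightarrow> 0) (at 0)"
proof -
  have "((\<lambda>x::real. x ^ k / exp x) \<longlongrightarrow> 0) at_top"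
    by (rule tendsto_power_div_exp_0)
  then have "((\<lambda>t::real. inverse t ^ k / exp (inverse t)) \<longlongrightarrow> 0) (at_right 0)"
    by (rule filterlim_compose[OF _ filterlim_inverse_at_top_right])
  then have "(flat_exp k \<longlongrightarrow> 0) (at_right 0)"
    by (rule filterlim_cong[THEN iffD1, rotated -1])
       (auto simp: flat_exp_def exp_minus field_simps eventually_at_filter)
  moreover have "(flat_exp k \<longlongrightarrow> 0) (at_left 0)"
    by (rule filterlim_cong[THEN iffD1, OF _ _ _ tendsto_const])
       (auto simp: flat_exp_def eventually_at_filter)
  ultimately show ?thesis
    by (rule filterlim_split_at_real[rotated])
qed

lemma flat_exp_deriv:
  "(flat_exp k has_real_derivative flat_exp (k + 2) t - k * flat_exp (Suc k) t) (at t)"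
proof (cases t "0::real" rule: linorder_cases)
  case less
  have "((\<lambda>_. 0) has_real_derivative 0) (at t)"
    by simp
  then have "(flat_exp k has_real_derivative 0) (at t)"
    by (rule DERIV_cong_ev[THEN iffD1, rotated -1])
       (use less eventually_nhds_in_open[of "{..<0}" t] in
         \<open>auto simp: flat_exp_def elim!: eventually_mono\<close>)
  then show ?thesis
    using less by (simp add: flat_exp_def)
next
  case equal
  \<comment> \<open>The difference quotient at 0 is the member of the family with index
    \<open>Suc k\<close>, whose limit is already known.\<close>
  have "((\<lambda>h. flat_exp k h / h) \<longlongrightarrow> 0) (at 0)"
    by (rule filterlim_cong[THEN iffD1, OF _ _ _ flat_exp_tendsto_0[of "Suc k"]])
       (auto simp: flat_exp_def eventually_at_filter)
  then show ?thesis
    using equal by (simp add: DERIV_def flat_exp_def)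
next
  case greater
  have "((\<lambda>t. exp (- (1 / t)) / t ^ k) has_real_derivative
      (exp (- (1 / t)) / t ^ 2 * t ^ k - exp (- (1 / t)) * (k * t ^ (k - 1))) / (t ^ k * t ^ k)) (at t)"
    using greater by (auto intro!: derivative_eq_intros simp: power2_eq_square)
  also have "(exp (- (1 / t)) / t ^ 2 * t ^ k - exp (- (1 / t)) * (k * t ^ (k - 1))) / (t ^ k * t ^ k)
      = flat_exp (k + 2) t - k * flat_exp (Suc k) t"
  proof -
    \<comment> \<open>For \<open>k = 0\<close> the exponent \<open>k - 1\<close> is truncated to 0,
      but its factor \<open>k\<close> vanishes; hence the case split.\<close>
    have "(E / t ^ 2 * t ^ k - E * (k * t ^ (k - 1))) / (t ^ k * t ^ k) =
        E / t ^ (k + 2) - k * (E / t ^ Suc k)" for E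
      using greater by (cases k) (simp_all add: diff_divide_distrib power_add power2_eq_square)
    then show ?thesis
      using greater by (simp add: flat_exp_def)
  qed
  finally show ?thesis
    by (rule DERIV_cong_ev[THEN iffD1, rotated -1])
       (use greater eventually_nhds_in_open[of "{0<..}" t] in
         \<open>auto simp: flat_exp_def elim!: eventually_mono\<close>)
qed

text \<open>The quadratic Taylor term alone gives
  \<open>exp (1 / t) \<ge> (1 / t)^2 / 2\<close>.\<close>

lemma flat_exp_2_le: "flat_exp 2 t \<le> 2"
proof (cases "t > 0")
  case True
  have "1 + 1 / t + (1 / t)\<^sup>2 / 2 \<le> exp (1 / t)"
    using True by (intro exp_lower_Taylor_quadratic) auto
  then have "(1 / t)\<^sup>2 / 2 \<le> exp (1 / t)"
    using True by (smt (verit) divide_pos_pos)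
  then show ?thesis
    using True by (simp add: flat_exp_def exp_minus field_simps)
qed (simp add: flat_exp_def)

lemma flat_exp_2_ge:
  assumes "1 / 2 \<le> t" "t \<le> 1"
  shows "flat_exp 2 t \<ge> exp (- 2)"
proof -
  have "t\<^sup>2 \<le> 1"
    using assms by (simp add: power_le_one)
  moreover have "exp (- 2) \<le> exp (- (1 / t))"
    using assms by (simp add: field_simps)
  moreover from \<open>t\<^sup>2 \<le> 1\<close> have "exp (- (1 / t)) \<le> exp (- (1 / t)) / t\<^sup>2"
    using assms by (simp add: field_simps)
  ultimately have "exp (- 2) \<le> exp (- (1 / t)) / t\<^sup>2"
    by linarith
  then show ?thesis
    using assms by (simp add: flat_exp_def)
qed

text \<open>The squared distance is a polynomial, so the bump is smooth at its centre too. The index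
  \<open>k\<close> keeps derivatives within reach of the family; the weak gradients are tested
  against \<open>bump 2 w r\<close>.\<close>

definition bump :: "nat \<Rightarrow> 'a::euclidean_space \<Rightarrow> real \<Rightarrow> 'a \<Rightarrow> real" where
  "bump k w r x = flat_exp k (1 - (x - w) \<bullet> (x - w) / r\<^sup>2)"

lemma bump_nonneg: "bump k w r x \<ge> 0"
  by (simp add: bump_def flat_exp_nonneg)

text \<open>For \<open>k = 0\<close> the second term drops out: the gradient of
  \<open>bump 0 w r\<close> is the vector \<open>x - w\<close> scaled by \<open>- 2 / r^2\<close>
  and by \<open>bump 2 w r x\<close>. This is what singles out the index 2 later.\<close>

lemma bump_has_derivative:
  "(bump k w r has_derivative
     (\<lambda>h. (bump (k + 2) w r x - k * bump (Suc k) w r x) * (- 2 / r\<^sup>2 * ((x - w) \<bullet> h)))) (at x)"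
proof -
  have "((\<lambda>x. 1 - (x - w) \<bullet> (x - w) / r\<^sup>2) has_derivative
      (\<lambda>h. - 2 / r\<^sup>2 * ((x - w) \<bullet> h))) (at x)"
    unfolding divide_inverse
    by (rule derivative_eq_intros refl)+ (auto simp: inner_commute algebra_simps)
  from has_derivative_compose[OF this flat_exp_deriv[unfolded has_field_derivative_def]]
  show ?thesis
    unfolding bump_def .
qed

lemma continuous_on_bump: "continuous_on S (bump k w r)"
  by (meson bump_has_derivative has_derivative_continuous continuous_at_imp_continuous_on)

text \<open>An algebra of functions that is closed under partial derivatives, hence consists of smooth
  functions.\<close>

inductive_set bump_algebra :: "'a::euclidean_space \<Rightarrow> real \<Rightarrow> ('a \<Rightarrow> real) set" for w r where
  const: "(\<lambda>_. c) \<in> bump_algebra w r"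
| coord: "(\<lambda>x. x \<bullet> e) \<in> bump_algebra w r"
| bump: "bump k w r \<in> bump_algebra w r"
| add: "f \<in> bump_algebra w r \<Longrightarrow> g \<in> bump_algebra w r \<Longrightarrow> (\<lambda>x. f x + g x) \<in> bump_algebra w r"
| mult: "f \<in> bump_algebra w r \<Longrightarrow> g \<in> bump_algebra w r \<Longrightarrow> (\<lambda>x. f x * g x) \<in> bump_algebra w r"

lemma bump_algebra_derivative:
  assumes "f \<in> bump_algebra w r"
  shows "\<exists>f'. (\<forall>x. (f has_derivative f' x) (at x)) \<and> (\<forall>e. (\<lambda>x. f' x e) \<in> bump_algebra w r)"
  using assms
proof induction
  case (const c)
  then show ?case
    by (intro exI[of _ "\<lambda>_ _. 0"]) (auto intro: bump_algebra.const)
next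
  case (coord e)
  then show ?case
    by (intro exI[of _ "\<lambda>_ h. h \<bullet> e"]) (auto intro!: bump_algebra.const derivative_eq_intros)
next
  case (bump k)
  \<comment> \<open>Subtraction is not among the generators, so differences are written as sums with
    negated constants.\<close>
  have "(\<lambda>x. (bump (k + 2) w r x + (- real k) * bump (Suc k) w r x) *
      (- 2 / r\<^sup>2 * (x \<bullet> e + - (w \<bullet> e)))) \<in> bump_algebra w r" for e
    by (intro bump_algebra.intros)
  then show ?case
    using bump_has_derivative[of k w r]
    by (intro exI[of _ "\<lambda>x h. (bump (k + 2) w r x - k * bump (Suc k) w r x) *
          (- 2 / r\<^sup>2 * ((x - w) \<bullet> h))"]) (auto simp: inner_diff_left)
next
  case (add f g)
  then obtain f' g' where
    "\<And>x. (f has_derivative f' x) (at x)" "\<And>e. (\<lambda>x. f' x e) \<in> bump_algebra w r"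
    "\<And>x. (g has_derivative g' x) (at x)" "\<And>e. (\<lambda>x. g' x e) \<in> bump_algebra w r"
    by metis
  then show ?case
    by (intro exI[of _ "\<lambda>x h. f' x h + g' x h"])
       (auto intro!: bump_algebra.add has_derivative_add)
next
  case (mult f g)
  then obtain f' g' where
    "\<And>x. (f has_derivative f' x) (at x)" "\<And>e. (\<lambda>x. f' x e) \<in> bump_algebra w r"
    "\<And>x. (g has_derivative g' x) (at x)" "\<And>e. (\<lambda>x. g' x e) \<in> bump_algebra w r"
    by metis
  then show ?case
    using mult.hyps
    by (intro exI[of _ "\<lambda>x h. f x * g' x h + f' x h * g x"])
       (auto intro!: bump_algebra.add bump_algebra.mult has_derivative_mult)
qed

text \<open>Induction on the order with \<open>f\<close> arbitrary, since partial derivatives stay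
  in the algebra.\<close>

lemma bump_algebra_smooth:
  "f \<in> bump_algebra w r \<Longrightarrow> times_continuously_differentiable k f"
proof (induction k arbitrary: f)
  case 0
  then obtain f' where "\<And>x. (f has_derivative f' x) (at x)"
    using bump_algebra_derivative by blast
  then show ?case
    by (auto intro!: continuous_at_imp_continuous_on has_derivative_continuous)
next
  case (Suc k)
  then obtain f' where f': "\<And>x. (f has_derivative f' x) (at x)"
      "\<And>e. (\<lambda>x. f' x e) \<in> bump_algebra w r"
    using bump_algebra_derivative by metis
  then have "frechet_derivative f (at x) = f' x" for x
    by (metis frechet_derivative_at)
  with f' Suc.IH show ?case
    by (auto simp: differentiable_on_def differentiable_def intro: has_derivative_at_withinI)
qed

lemma bump_eq_0: "r > 0 \<Longrightarrow> x \<notin> cball w r \<Longrightarrow> bump k w r x = 0"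
proof -
  assume "r > 0" "x \<notin> cball w r"
  then have "r\<^sup>2 < (norm (x - w))\<^sup>2"
    by (intro power_strict_mono) (auto simp: dist_norm norm_minus_commute)
  then have "r\<^sup>2 < (x - w) \<bullet> (x - w)"
    by (simp add: power2_norm_eq_inner)
  then show ?thesis
    using \<open>r > 0\<close> by (simp add: bump_def flat_exp_def)
qed

lemma bump_test_function:
  assumes "r > 0" "cball w r \<subseteq> U"
  shows "bump k w r \<in> test_functions U"
proof -
  have "closure {x. bump k w r x \<noteq> 0} \<subseteq> cball w r"
    using bump_eq_0[OF assms(1), of _ w k] by (intro closure_minimal) blast+
  then show ?thesis
    using assms bump_algebra_smooth[OF bump_algebra.bump]
    by (auto simp: test_functions_def compact_eq_bounded_closed intro: bounded_subset[OF bounded_cball])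
qed

lemma bump_2_le: "r > 0 \<Longrightarrow> bump 2 w r x \<le> 2 * indicator (cball w r) x"
  using bump_eq_0[of r x w 2] flat_exp_2_le by (auto simp: bump_def indicator_def)

text \<open>On the ball of half the radius the argument of \<open>flat_exp 2\<close> is at least
  3/4, inside the interval where a positive lower bound is available.\<close>

lemma bump_2_ge:
  assumes "r > 0"
  shows "exp (- 2) * indicator (cball w (r / 2)) x \<le> bump 2 w r x"
proof (cases "x \<in> cball w (r / 2)")
  case True
  then have "norm (x - w) \<le> r / 2"
    by (simp add: dist_norm norm_minus_commute)
  then have "(norm (x - w))\<^sup>2 \<le> (r / 2)\<^sup>2"
    by (intro power_mono) auto
  then have "(x - w) \<bullet> (x - w) / r\<^sup>2 \<le> 1 / 4"
    using assms by (simp add: power2_norm_eq_inner field_simps)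
  moreover have "0 \<le> (x - w) \<bullet> (x - w) / r\<^sup>2"
    by simp
  ultimately have "exp (- 2) \<le> bump 2 w r x"
    unfolding bump_def by (intro flat_exp_2_ge) linarith+
  then show ?thesis
    using True by simp
qed (simp add: bump_nonneg)

section \<open>Integration by parts\<close>

lemma integrable_continuous_compact_support:
  fixes g :: "'a::euclidean_space \<Rightarrow> 'b::{banach, second_countable_topology}"
  assumes "continuous_on UNIV g" "compact K" "\<And>x. x \<notin> K \<Longrightarrow> g x = 0"
  shows "integrable lborel g"
proof -
  have "(\<lambda>x. indicator K x *\<^sub>R g x) = g"
    using assms(3) by (auto simp: indicator_def)
  then show ?thesis
    using borel_integrable_compact[OF assms(2), of g] assms(1) by (metis continuous_on_subset subset_UNIV)
qed

lemma lborel_integral_translation: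
  fixes g :: "'a::euclidean_space \<Rightarrow> 'b::{banach, second_countable_topology}"
  assumes "g \<in> borel_measurable borel"
  shows "(\<integral>x. g (x + a) \<partial>lborel) = (\<integral>x. g x \<partial>lborel)"
proof -
  have "(\<integral>x. g x \<partial>lborel) = (\<integral>x. g x \<partial>distr lborel borel ((+) a))"
    by (simp add: lborel_distr_plus)
  also have "\<dots> = (\<integral>x. g (a + x) \<partial>lborel)"
    using assms by (subst integral_distr) auto
  finally show ?thesis
    by (simp add: add.commute)
qed

lemma derivative_outside_support:
  assumes "closed K" and K: "\<And>x. x \<notin> K \<Longrightarrow> g x = 0"
    and "(g has_derivative g') (at x)" and "x \<notin> K"
  shows "g' e = 0"
proof -
  have "((\<lambda>_. 0) has_derivative g') (at x)"
    using assms by (intro has_derivative_transform_within_open[OF assms(3), of "- K"]) auto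
  then show ?thesis
    by (metis has_derivative_const has_derivative_unique)
qed

text \<open>By translation invariance every difference quotient of \<open>g\<close> in direction
  \<open>e\<close> has integral zero; dominated convergence carries this over to the
  derivative.\<close>

lemma integral_directional_derivative_eq_0:
  fixes g :: "'a::euclidean_space \<Rightarrow> 'b::euclidean_space"
  assumes "compact K" and K: "\<And>x. x \<notin> K \<Longrightarrow> g x = 0"
    and g': "\<And>x. (g has_derivative g' x) (at x)"
    and cont: "continuous_on UNIV (\<lambda>x. g' x e)"
  shows "integrable lborel (\<lambda>x. g' x e)" and "(\<integral>x. g' x e \<partial>lborel) = 0"
proof -
  have contg: "continuous_on UNIV g"
    by (meson g' has_derivative_continuous continuous_at_imp_continuous_on)
  then have [measurable]: "g \<in> borel_measurable borel"
    by (rule borel_measurable_continuous_onI)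
  have g'_0: "g' x e = 0" if "x \<notin> K" for x
    using derivative_outside_support[OF compact_imp_closed[OF \<open>compact K\<close>] K g' that] .
  show "integrable lborel (\<lambda>x. g' x e)"
    by (rule integrable_continuous_compact_support[OF cont \<open>compact K\<close> g'_0])
  have intg: "integrable lborel g"
    by (rule integrable_continuous_compact_support[OF contg \<open>compact K\<close> K])
  have "compact ((\<lambda>x. g' x e) ` K)"
    using \<open>compact K\<close> cont by (meson compact_continuous_image continuous_on_subset subset_UNIV)
  then obtain M0 where "\<And>x. x \<in> K \<Longrightarrow> norm (g' x e) \<le> M0"
    by (meson compact_imp_bounded bounded_iff imageI)
  \<comment> \<open>\<open>M0\<close> may be negative when \<open>K\<close> is empty; the maximum
    with 0 also covers the points outside \<open>K\<close>.\<close>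
  then have M: "norm (g' x e) \<le> max 0 M0" for x
    using g'_0[of x] by (cases "x \<in> K") (auto simp: le_max_iff_disj)
  define M where "M = max 0 M0"
  have line: "((\<lambda>t. g (x + t *\<^sub>R e)) has_vector_derivative g' (x + t *\<^sub>R e) e) (at t)" for x t
  proof -
    have "((\<lambda>t. x + t *\<^sub>R e) has_derivative (\<lambda>h. h *\<^sub>R e)) (at t)"
      by (auto intro!: derivative_eq_intros)
    from has_derivative_compose[OF this g'] show ?thesis
      using linear_scale[OF has_derivative_linear[OF g']] by (simp add: has_vector_derivative_def)
  qed
  \<comment> \<open>The difference quotient with step \<open>1 / (n + 1)\<close>. Steps are at most
    1, so no shift is longer than \<open>norm e\<close>.\<close>
  define q where "q n x = real (Suc n) *\<^sub>R (g (x + inverse (real (Suc n)) *\<^sub>R e) - g x)" for n x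
  obtain R where R: "K \<subseteq> cball 0 R"
    using \<open>compact K\<close>
    by (metis bounded_any_center compact_imp_bounded mem_cball subsetI)
  have "(\<lambda>n. \<integral>x. q n x \<partial>lborel) \<longlonglongrightarrow> (\<integral>x. g' x e \<partial>lborel)"
  proof (rule integral_dominated_convergence)
    \<comment> \<open>The ball is enlarged by \<open>norm e\<close> because \<open>q n x\<close> can
      be nonzero when only the shifted point lies in \<open>K\<close>.\<close>
    show "integrable lborel (\<lambda>x. M * indicat_real (cball 0 (R + norm e)) x)"
      by (intro integrable_mult_right integrable_real_indicator)
         (auto intro: emeasure_bounded_finite[unfolded infinity_ennreal_def])
    have "(\<lambda>n. q n x) \<longlonglongrightarrow> g' x e" for x
    proof -
      have "((\<lambda>h. inverse h *\<^sub>R (g (x + h *\<^sub>R e) - g x)) \<longlongrightarrow> g' x e) (at 0)"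
      proof (rule LIM_zero_cancel, rule tendsto_norm_zero_cancel)
        have "((\<lambda>h. norm (g (x + h *\<^sub>R e) - g x - h *\<^sub>R g' x e) / norm h) \<longlongrightarrow> 0) (at 0)"
          using line[of x 0] by (simp add: has_vector_derivative_def has_derivative_at)
        then show "((\<lambda>h. norm (inverse h *\<^sub>R (g (x + h *\<^sub>R e) - g x) - g' x e)) \<longlongrightarrow> 0) (at 0)"
        proof (rule filterlim_cong[THEN iffD1, OF refl refl, rotated])
          have "norm (inverse h *\<^sub>R (g (x + h *\<^sub>R e) - g x) - g' x e) =
              norm (g (x + h *\<^sub>R e) - g x - h *\<^sub>R g' x e) / norm h" if "h \<noteq> 0" for h
          proof -
            have "inverse h *\<^sub>R (g (x + h *\<^sub>R e) - g x) - g' x e =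
                inverse h *\<^sub>R (g (x + h *\<^sub>R e) - g x - h *\<^sub>R g' x e)"
              using that by (simp add: scaleR_right_diff_distrib)
            then show ?thesis
              by (simp add: divide_inverse mult.commute)
          qed
          then show "\<forall>\<^sub>F h in at 0. norm (g (x + h *\<^sub>R e) - g x - h *\<^sub>R g' x e) / norm h =
              norm (inverse h *\<^sub>R (g (x + h *\<^sub>R e) - g x) - g' x e)"
            by (simp add: eventually_at_filter)
        qed
      qed
      moreover have "filterlim (\<lambda>n. inverse (real (Suc n))) (at 0) sequentially"
        unfolding filterlim_at using LIMSEQ_inverse_real_of_nat by auto
      ultimately show ?thesis
        unfolding q_def by (metis (no_types, lifting) ext filterlim_compose inverse_inverse_eq)
    qed
    then show "AE x in lborel. (\<lambda>n. q n x) \<longlonglongrightarrow> g' x e"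
      by simp
    have "norm (q n x) \<le> M * indicator (cball 0 (R + norm e)) x" for n x
    proof (cases "x \<in> cball 0 (R + norm e)")
      case True
      \<comment> \<open>Mean value inequality along the segment from \<open>x\<close>; the length of
        the step then cancels against the factor \<open>Suc n\<close> in
        \<open>q n x\<close>.\<close>
      have "norm (g (x + inverse (real (Suc n)) *\<^sub>R e) - g (x + 0 *\<^sub>R e)) \<le>
          M * inverse (real (Suc n)) - M * 0"
      proof (rule differentiable_bound_general[where \<phi> = "\<lambda>t. M * t" and \<phi>' = "\<lambda>_. M"
            and f = "\<lambda>t. g (x + t *\<^sub>R e)"])
        show "continuous_on {0..inverse (real (Suc n))} (\<lambda>t. g (x + t *\<^sub>R e))"
          using contg by (auto intro!: continuous_on_compose2[of UNIV g] continuous_intros)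
      qed (use line M in \<open>auto simp: M_def intro!: continuous_intros derivative_eq_intros\<close>)
      moreover have "norm (q n x) =
          real (Suc n) * norm (g (x + inverse (real (Suc n)) *\<^sub>R e) - g (x + 0 *\<^sub>R e))"
        by (simp add: q_def del: of_nat_Suc)
      ultimately show ?thesis
        using True by (simp add: field_simps del: of_nat_Suc)
    next
      case False
      have "inverse (real (Suc n)) \<le> 1"
        by (simp add: inverse_le_1_iff)
      then have "norm (inverse (real (Suc n)) *\<^sub>R e) \<le> norm e"
        by (simp add: mult_left_le_one_le)
      moreover have "norm x > R + norm e"
        using False by simp
      ultimately have "norm (x + inverse (real (Suc n)) *\<^sub>R e) > R" "norm x > R"
        using norm_diff_ineq[of x "inverse (real (Suc n)) *\<^sub>R e"] norm_ge_zero[of e] by linarith+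
      then have "x + inverse (real (Suc n)) *\<^sub>R e \<notin> K" "x \<notin> K"
        using R by force+
      then show ?thesis
        using K by (simp add: q_def M_def)
    qed
    then show "AE x in lborel. norm (q n x) \<le> M * indicator (cball 0 (R + norm e)) x" for n
      by simp
    show "q n \<in> borel_measurable lborel" for n
      unfolding q_def by measurable
    show "(\<lambda>x. g' x e) \<in> borel_measurable lborel"
      using cont by (simp add: borel_measurable_continuous_onI)
  qed
  moreover have "(\<integral>x. q n x \<partial>lborel) = 0" for n
  proof -
    let ?a = "inverse (real (Suc n)) *\<^sub>R e"
    have "integrable lborel (\<lambda>x. g (x + ?a))"
      using intg by (subst (asm) lborel_distr_plus[symmetric, of ?a])
        (simp add: integrable_distr_eq add.commute)
    then show ?thesis
      unfolding q_def using intg lborel_integral_translation[of g ?a] by simp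
  qed
  ultimately show "(\<integral>x. g' x e \<partial>lborel) = 0"
    by (simp add: LIMSEQ_const_iff)
qed

text \<open>Continuity is pasted over the open cover formed by \<open>U\<close> and the complement
  of \<open>K\<close>, on which \<open>g\<close> is zero.\<close>

lemma continuous_on_UNIV_supported:
  fixes g :: "'a::topological_space \<Rightarrow> 'b::real_normed_vector"
  assumes "open U" "closed K" "K \<subseteq> U" "continuous_on U g" "\<And>x. x \<notin> K \<Longrightarrow> g x = 0"
  shows "continuous_on UNIV g"
proof -
  have "continuous_on (- K) g"
    using assms(5) by (subst continuous_on_cong[OF refl, of _ _ "\<lambda>_. 0"]) auto
  then have "continuous_on (U \<union> - K) g"
    using assms by (intro continuous_on_open_Un) auto
  moreover have "U \<union> - K = UNIV"
    using assms(3) by auto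
  ultimately show ?thesis
    by simp
qed

text \<open>The product of \<open>f\<close> and \<open>\<beta>\<close> vanishes outside
  \<open>K\<close>, so the integral of its derivative in direction \<open>e\<close> is zero. A
  holomorphic \<open>f\<close> has derivative \<open>e * deriv f x\<close> in that direction, and
  the constant \<open>e\<close> leaves the integral.\<close>

lemma holomorphic_integration_by_parts:
  fixes f :: "complex \<Rightarrow> complex" and \<beta> :: "complex \<Rightarrow> real"
  assumes f: "f holomorphic_on U" and U: "open U" and K: "compact K" "K \<subseteq> U"
    and supp: "\<And>x. x \<notin> K \<Longrightarrow> \<beta> x = 0"
    and \<beta>': "\<And>x. (\<beta> has_derivative \<beta>' x) (at x)" "continuous_on UNIV (\<lambda>x. \<beta>' x e)"
  shows "integrable lborel (\<lambda>x. f x * complex_of_real (\<beta> x))"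
    and "integrable lborel (\<lambda>x. f x * complex_of_real (\<beta>' x e))"
    and "e * (\<integral>x. deriv f x * complex_of_real (\<beta> x) \<partial>lborel) =
         - (\<integral>x. f x * complex_of_real (\<beta>' x e) \<partial>lborel)"
proof -
  have "closed K"
    using K by (simp add: compact_imp_closed)
  have supp': "\<beta>' x e = 0" if "x \<notin> K" for x
    using derivative_outside_support[OF \<open>closed K\<close> supp \<beta>'(1) that] .
  have f': "deriv f holomorphic_on U"
    using f U by (rule holomorphic_deriv)
  have cont_\<beta>: "continuous_on UNIV \<beta>"
    by (meson \<beta>' has_derivative_continuous continuous_at_imp_continuous_on)
  have intg: "integrable lborel (\<lambda>x. h x * complex_of_real (b x))"
    if h: "h holomorphic_on U" and b: "continuous_on UNIV b" "\<And>x. x \<notin> K \<Longrightarrow> b x = 0" for h b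
  proof (rule integrable_continuous_compact_support[OF _ K(1)])
    show "continuous_on UNIV (\<lambda>x. h x * complex_of_real (b x))"
      using that \<open>closed K\<close> K(2) U holomorphic_on_imp_continuous_on[OF h]
      by (intro continuous_on_UNIV_supported[of U K])
         (auto intro!: continuous_intros intro: continuous_on_subset[OF b(1)])
  qed (use that in auto)
  show int1: "integrable lborel (\<lambda>x. f x * complex_of_real (\<beta>' x e))"
    by (rule intg[OF f \<beta>'(2) supp'])
  show "integrable lborel (\<lambda>x. f x * complex_of_real (\<beta> x))"
    by (rule intg[OF f cont_\<beta> supp])
  have int2: "integrable lborel (\<lambda>x. deriv f x * complex_of_real (\<beta> x))"
    by (rule intg[OF f' cont_\<beta> supp])
  \<comment> \<open>Outside \<open>U\<close> nothing is known about \<open>f\<close>, but the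
    product is zero near such a point, so 0 is the correct derivative there.\<close>
  define g' where "g' x h = (if x \<in> U then deriv f x * h * complex_of_real (\<beta> x) +
      f x * complex_of_real (\<beta>' x h) else 0)" for x h
  \<comment> \<open>In direction \<open>e\<close> the case distinction disappears, since
    \<open>\<beta>\<close> and its derivative both vanish outside \<open>K\<close>.\<close>
  have g'_e: "g' x e = e * (deriv f x * complex_of_real (\<beta> x)) + f x * complex_of_real (\<beta>' x e)" for x
    using supp[of x] supp'[of x] K(2) by (cases "x \<in> K") (auto simp: g'_def)
  have "(\<integral>x. g' x e \<partial>lborel) = 0"
  proof (rule integral_directional_derivative_eq_0(2)[OF K(1)])
    show "((\<lambda>x. f x * complex_of_real (\<beta> x)) has_derivative g' x) (at x)" for x
    proof (cases "x \<in> U")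
      case True
      have "(f has_derivative (*) (deriv f x)) (at x)"
        using holomorphic_derivI[OF f U True] by (simp add: has_field_derivative_def)
      from has_derivative_mult[OF this has_derivative_of_real[OF \<beta>'(1)]] show ?thesis
        using True by (simp add: g'_def[abs_def] add.commute)
    next
      case False
      then have "x \<in> - K"
        using K by auto
      have "((\<lambda>x. f x * complex_of_real (\<beta> x)) has_derivative (\<lambda>_. 0)) (at x)"
        using \<open>closed K\<close> supp
        by (intro has_derivative_transform_within_open[OF has_derivative_const _ \<open>x \<in> - K\<close>]) auto
      then show ?thesis
        using False by (simp add: g'_def[abs_def])
    qed
    show "continuous_on UNIV (\<lambda>x. g' x e)"
      using \<open>closed K\<close> K(2) U supp supp' holomorphic_on_imp_continuous_on[OF f]
        holomorphic_on_imp_continuous_on[OF f'] unfolding g'_e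
      by (intro continuous_on_UNIV_supported[of U K])
         (auto intro!: continuous_intros
           intro: continuous_on_subset[OF cont_\<beta>] continuous_on_subset[OF \<beta>'(2)])
  qed (use supp in auto)
  then have "(\<integral>x. e * (deriv f x * complex_of_real (\<beta> x)) \<partial>lborel) +
      (\<integral>x. f x * complex_of_real (\<beta>' x e) \<partial>lborel) = 0"
    unfolding g'_e using int1 int2 by simp
  then show "e * (\<integral>x. deriv f x * complex_of_real (\<beta> x) \<partial>lborel) =
         - (\<integral>x. f x * complex_of_real (\<beta>' x e) \<partial>lborel)"
    by (simp add: eq_neg_iff_add_eq_0)
qed

section \<open>Mean value property for radial bumps\<close>

lemma continuous_on_bump_derivative:
  "continuous_on S (\<lambda>x. (bump (k + 2) w r x - k * bump (Suc k) w r x) * (- 2 / r\<^sup>2 * ((x - w) \<bullet> e)))"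
  by (intro continuous_intros continuous_on_bump)

text \<open>Writing \<open>f z = f w + (z - w) * h z\<close>, the remainder integrates to zero because
  \<open>(z - w) * bump 2 w r z\<close> is a multiple of the Wirtinger derivative
  \<open>(\<partial>\<^sub>1 + \<i> \<partial>\<^sub>\<i>) (bump 0 w r)\<close>, and this operator annihilates \<open>h\<close>.\<close>

lemma holomorphic_bump_mean_value:
  assumes f: "f holomorphic_on U" and U: "open U" and r: "r > 0" "cball w r \<subseteq> U"
  shows "(\<integral>x. f x * complex_of_real (bump 2 w r x) \<partial>lborel) =
         f w * complex_of_real (\<integral>x. bump 2 w r x \<partial>lborel)"
proof -
  \<comment> \<open>The value at \<open>w\<close> fills the removable singularity of the difference
    quotient, which makes \<open>h\<close> holomorphic on all of \<open>U\<close>.\<close>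
  define h where "h z = (if z = w then deriv f w else (f z - f w) / (z - w))" for z
  have h: "h holomorphic_on U"
    unfolding h_def by (rule pole_lemma_open[OF f U])
  define I where "I = (\<integral>x. deriv h x * complex_of_real (bump 0 w r x) \<partial>lborel)"
  \<comment> \<open>The derivative of \<open>bump 0 w r\<close> in direction \<open>e\<close>, with
    the term carrying the factor \<open>k = 0\<close> left out.\<close>
  define b where "b e x = bump 2 w r x * (- 2 / r\<^sup>2 * ((x - w) \<bullet> e))" for e x
  have b: "(bump 0 w r has_derivative (\<lambda>e. b e x)) (at x)" "continuous_on UNIV (b e)" for x e
    using bump_has_derivative[of 0 w r x] continuous_on_bump_derivative[of UNIV 0 w r e]
    by (simp_all add: b_def[abs_def] numeral_2_eq_2)
  have int: "integrable lborel (\<lambda>x. h x * complex_of_real (b e x))" for e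
    by (rule holomorphic_integration_by_parts(2)[OF h U compact_cball r(2) bump_eq_0[OF r(1)] b])
  \<comment> \<open>One number \<open>I\<close> serves all directions, because the derivative of
    \<open>h\<close> in direction \<open>e\<close> is \<open>e * deriv h x\<close>.\<close>
  have "e * I = - (\<integral>x. h x * complex_of_real (b e x) \<partial>lborel)" for e
    unfolding I_def
    by (rule holomorphic_integration_by_parts(3)[OF h U compact_cball r(2) bump_eq_0[OF r(1)] b])
  then have J: "(\<integral>x. h x * complex_of_real (b e x) \<partial>lborel) = - (e * I)" for e
    by (metis minus_minus)
  have b_sum: "h x * complex_of_real (b 1 x) + \<i> * (h x * complex_of_real (b \<i> x)) =
      complex_of_real (- 2 / r\<^sup>2) * ((f x - f w) * complex_of_real (bump 2 w r x))" for x
  proof -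
    have b: "complex_of_real (b 1 x) + \<i> * complex_of_real (b \<i> x) =
        complex_of_real (- 2 / r\<^sup>2) * complex_of_real (bump 2 w r x) * (x - w)"
      by (simp add: b_def complex_eq_iff)
    have f: "f x - f w = h x * (x - w)"
      by (simp add: h_def)
    have "h x * a + \<i> * (h x * b) = c * (h x * y * d)" if "a + \<i> * b = c * d * y" for a b c d y
    proof -
      have "h x * a + \<i> * (h x * b) = h x * (a + \<i> * b)"
        by (simp add: distrib_left mult.left_commute)
      then show ?thesis
        by (simp add: that mult_ac)
    qed
    from this[OF b] show ?thesis
      by (simp only: f)
  qed
  have bump_int: "integrable lborel (bump 2 w r)"
    by (rule integrable_continuous_compact_support[OF continuous_on_bump compact_cball])
       (rule bump_eq_0[OF r(1)])
  have f_int: "integrable lborel (\<lambda>x. f x * complex_of_real (bump 2 w r x))"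
    by (rule holomorphic_integration_by_parts(1)[OF f U compact_cball r(2)
      bump_eq_0[OF r(1)] bump_has_derivative continuous_on_bump_derivative])
  have "complex_of_real (- 2 / r\<^sup>2) * (\<integral>x. (f x - f w) * complex_of_real (bump 2 w r x) \<partial>lborel) =
      (\<integral>x. h x * complex_of_real (b 1 x) + \<i> * (h x * complex_of_real (b \<i> x)) \<partial>lborel)"
    unfolding b_sum by simp
  \<comment> \<open>The directions \<open>1\<close> and \<open>\<i>\<close> contribute
    \<open>- I\<close> and \<open>+ I\<close>; this cancellation expresses the Cauchy-Riemann
    equations for \<open>h\<close>.\<close>
  also have "\<dots> = - I + \<i> * (- (\<i> * I))"
    using int[of 1] int[of \<i>] by (simp add: J)
  also have "\<dots> = 0"
    by simp
  finally have "(\<integral>x. (f x - f w) * complex_of_real (bump 2 w r x) \<partial>lborel) = 0"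
    using r(1) by simp
  then have "(\<integral>x. f x * complex_of_real (bump 2 w r x) \<partial>lborel) =
      (\<integral>x. f w * complex_of_real (bump 2 w r x) \<partial>lborel)"
    using f_int bump_int by (simp add: left_diff_distrib)
  then show ?thesis
    using bump_int by simp
qed

section \<open>Pointwise bounds from weak gradients\<close>

text \<open>The partial derivative of \<open>f\<close> in the real direction is
  \<open>deriv f\<close>, so testing in direction 1 suffices. Both sides equal the negated integral
  of \<open>f x \<bullet> j\<close> against the derivative of the bump: one by classical integration
  by parts, the other by the definition of the weak gradient.\<close>

lemma weak_gradient_bump:
  fixes f :: "complex \<Rightarrow> complex"
  assumes f: "f holomorphic_on U" and U: "open U" and r: "r > 0" "cball w r \<subseteq> U"
    and v: "has_weak_gradient_on (\<lambda>x. f x \<bullet> j) v U"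
  shows "(\<integral>x. deriv f x * complex_of_real (bump 2 w r x) \<partial>lborel) \<bullet> j =
         (LINT x:U|lebesgue. (v x \<bullet> 1) * bump 2 w r x)"
proof -
  define \<beta>' where "\<beta>' x h = (bump (2 + 2) w r x - real 2 * bump (Suc 2) w r x) *
      (- 2 / r\<^sup>2 * ((x - w) \<bullet> h))" for x h
  have \<beta>': "(bump 2 w r has_derivative \<beta>' x) (at x)" for x
    using bump_has_derivative[of 2 w r x] by (simp add: \<beta>'_def[abs_def])
  have cont: "continuous_on UNIV (\<lambda>x. \<beta>' x 1)"
    unfolding \<beta>'_def by (rule continuous_on_bump_derivative)
  have parts1: "integrable lborel (\<lambda>x. f x * complex_of_real (\<beta>' x 1))"
    by (rule holomorphic_integration_by_parts(2)[OF f U compact_cball r(2) bump_eq_0[OF r(1)] \<beta>' cont])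
  have parts2: "1 * (\<integral>x. deriv f x * complex_of_real (bump 2 w r x) \<partial>lborel) =
       - (\<integral>x. f x * complex_of_real (\<beta>' x 1) \<partial>lborel)"
    by (rule holomorphic_integration_by_parts(3)[OF f U compact_cball r(2) bump_eq_0[OF r(1)] \<beta>' cont])
  have supp': "\<beta>' x 1 = 0" if "x \<notin> U" for x
    using r(2) that
    by (intro derivative_outside_support[OF closed_cball bump_eq_0[OF r(1)] \<beta>']) auto
  have int: "integrable lborel (\<lambda>x. (f x \<bullet> j) * \<beta>' x 1)"
  proof -
    have "integrable lborel (\<lambda>x. (f x * complex_of_real (\<beta>' x 1)) \<bullet> j)"
      using parts1 by simp
    then show ?thesis
      by (simp add: inner_complex_def algebra_simps)
  qed
  have "(\<integral>x. deriv f x * complex_of_real (bump 2 w r x) \<partial>lborel) \<bullet> j =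
      - ((\<integral>x. f x * complex_of_real (\<beta>' x 1) \<partial>lborel) \<bullet> j)"
    using parts2 by simp
  also have "\<dots> = - (\<integral>x. (f x * complex_of_real (\<beta>' x 1)) \<bullet> j \<partial>lborel)"
    using parts1 by simp
  also have "\<dots> = - (\<integral>x. (f x \<bullet> j) * \<beta>' x 1 \<partial>lborel)"
    by (simp add: inner_complex_def algebra_simps)
  also have "\<dots> = - (\<integral>x. (f x \<bullet> j) * \<beta>' x 1 \<partial>lebesgue)"
    using int by (subst integral_completion) auto
  \<comment> \<open>The derivative of the bump vanishes outside \<open>U\<close>, so restricting the
    integral to \<open>U\<close> changes nothing.\<close>
  also have "\<dots> = - (LINT x:U|lebesgue. (f x \<bullet> j) * frechet_derivative (bump 2 w r) (at x) 1)"
    unfolding set_lebesgue_integral_def frechet_derivative_at[OF \<beta>', symmetric]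
    using supp' by (intro arg_cong[where f = uminus] Bochner_Integration.integral_cong)
      (auto simp: indicator_def)
  also have "\<dots> = (LINT x:U|lebesgue. (v x \<bullet> 1) * bump 2 w r x)"
    using v bump_test_function[OF r, of 2] unfolding has_weak_gradient_on_def
    by (auto simp: Basis_complex_def)
  finally show ?thesis .
qed

text \<open>For \<open>a > s\<close> the factor \<open>(a / s) powr (p - 1)\<close> is at least 1.
  Integrating this pointwise split with a well-chosen \<open>s\<close> takes the place of Hoelder's
  inequality.\<close>

lemma le_add_powr:
  fixes a s p :: real
  assumes "a \<ge> 0" "s > 0" "p > 1"
  shows "a \<le> s + s powr (1 - p) * a powr p"
proof (cases "a \<le> s")
  case False
  have "1 = s powr (1 - p) * s powr (p - 1)"
    using assms by (simp flip: powr_add)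
  also have "\<dots> \<le> s powr (1 - p) * a powr (p - 1)"
    using assms False by (intro mult_left_mono powr_mono2) auto
  finally have "a \<le> s powr (1 - p) * a powr (p - 1) * a"
    using assms by (simp add: mult_right_mono mult_le_cancel_right1)
  also have "\<dots> = s powr (1 - p) * a powr p"
    using assms False powr_add[of a "p - 1" 1] by simp
  finally show ?thesis
    using assms by simp
qed (simp add: add_increasing2)

text \<open>The exponent \<open>2 - 2 / p\<close> is the one Hoelder's inequality gives on a disc of
  area \<open>pi * r^2\<close>. The integral of the \<open>p\<close>-th power enters without a root,
  which is harmless because only the dependence on \<open>r\<close> matters afterwards.\<close>

lemma Lp_bump_bound:
  fixes v :: "complex \<Rightarrow> complex"
  assumes v: "v \<in> Lp_space p U" and U: "open U" and "p > 1" "r > 0" "norm e \<le> 1"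
  shows "\<bar>LINT x:U|lebesgue. (v x \<bullet> e) * bump 2 w r x\<bar> \<le>
    2 * r powr (2 - 2 / p) * (pi + (\<integral>x. norm (v x) powr p \<partial>lebesgue_on U))"
proof -
  \<comment> \<open>This level balances the two terms of the split: \<open>s * r^2\<close> and
    \<open>s powr (1 - p)\<close> both equal \<open>r powr (2 - 2 / p)\<close>.\<close>
  define s where "s = r powr (- (2 / p))"
  have [simp]: "U \<in> sets lebesgue"
    using U by (simp add: borel_open)
  have "s > 0"
    using \<open>r > 0\<close> by (simp add: s_def)
  have int: "integrable lebesgue (\<lambda>x. indicator U x * norm (v x) powr p)"
    and N: "(\<integral>x. norm (v x) powr p \<partial>lebesgue_on U) = (\<integral>x. indicator U x * norm (v x) powr p \<partial>lebesgue)"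
    using v by (auto simp: Lp_space_def integrable_restrict_space integral_restrict_space)
  have "integrable lborel (indicat_real (cball w r))"
    by (intro integrable_real_indicator)
       (auto intro: emeasure_bounded_finite[unfolded infinity_ennreal_def])
  then have ball: "integrable lebesgue (indicat_real (cball w r))"
    by (subst integrable_completion) auto
  have ball_area: "(\<integral>x. indicat_real (cball w r) x \<partial>lebesgue) = pi * r\<^sup>2"
    using \<open>r > 0\<close> by (simp add: content_cball unit_ball_vol_2)
  \<comment> \<open>The second term is integrated over all of \<open>U\<close> instead of the disc,
    which keeps the final bound independent of \<open>w\<close>. The factors 2 come from the upper
    bound on the bump.\<close>
  define B where "B x = 2 * s * indicat_real (cball w r) x +
      2 * s powr (1 - p) * (indicator U x * norm (v x) powr p)" for x
  have bound: "norm (indicator U x *\<^sub>R ((v x \<bullet> e) * bump 2 w r x)) \<le> B x" for x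
  proof (cases "x \<in> U")
    case True
    have "\<bar>v x \<bullet> e\<bar> \<le> norm (v x) * norm e"
      by (rule Cauchy_Schwarz_ineq2)
    also have "\<dots> \<le> norm (v x)"
      using assms by (simp add: mult_left_le)
    also have "\<dots> \<le> s + s powr (1 - p) * norm (v x) powr p"
      using \<open>s > 0\<close> \<open>p > 1\<close> by (intro le_add_powr) auto
    finally have "\<bar>v x \<bullet> e\<bar> * bump 2 w r x \<le>
        (s + s powr (1 - p) * norm (v x) powr p) * (2 * indicator (cball w r) x)"
      using bump_2_le[OF \<open>r > 0\<close>, of w x] \<open>s > 0\<close> by (intro mult_mono) (auto simp: bump_nonneg)
    also have "\<dots> \<le> B x"
      using True by (auto simp: B_def indicator_def algebra_simps)
    finally show ?thesis
      using True by (simp add: abs_mult bump_nonneg)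
  qed (use \<open>s > 0\<close> in \<open>simp add: B_def\<close>)
  have "\<bar>LINT x:U|lebesgue. (v x \<bullet> e) * bump 2 w r x\<bar> \<le>
      (\<integral>x. norm (indicator U x *\<^sub>R ((v x \<bullet> e) * bump 2 w r x)) \<partial>lebesgue)"
    unfolding set_lebesgue_integral_def
    using integral_norm_bound[of lebesgue "\<lambda>x. indicator U x *\<^sub>R ((v x \<bullet> e) * bump 2 w r x)"]
    by (simp only: real_norm_def)
  also have "\<dots> \<le> (\<integral>x. B x \<partial>lebesgue)"
  proof (rule integral_mono')
    show "integrable lebesgue B"
      unfolding B_def using int ball by simp
    show "norm (indicator U x *\<^sub>R ((v x \<bullet> e) * bump 2 w r x)) \<le> B x" for x
      by (rule bound)
  qed (use \<open>s > 0\<close> in \<open>simp add: B_def\<close>)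
  also have "\<dots> = 2 * (s * (pi * r\<^sup>2)) +
      2 * (s powr (1 - p) * (\<integral>x. norm (v x) powr p \<partial>lebesgue_on U))"
    unfolding B_def N using int ball ball_area by simp
  also have "s powr (1 - p) = r powr (2 - 2 / p)"
  proof -
    have "- (2 / p) * (1 - p) = 2 - 2 / p"
      using \<open>p > 1\<close> by (simp add: field_simps)
    then show ?thesis
      unfolding s_def powr_powr by simp
  qed
  also have "s * (pi * r\<^sup>2) = pi * r powr (2 - 2 / p)"
    using \<open>r > 0\<close> by (simp add: s_def powr_diff powr_minus divide_inverse)
  finally show ?thesis
    by (simp add: algebra_simps)
qed

section \<open>Growth of the derivative towards the boundary\<close>

lemma bump_2_integral_ge:
  fixes w :: complex
  assumes "r > 0"
  shows "exp (- 2) * (pi * (r / 2)\<^sup>2) \<le> (\<integral>x. bump 2 w r x \<partial>lborel)"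
proof -
  have "exp (- 2) * (pi * (r / 2)\<^sup>2) = (\<integral>x. exp (- 2) * indicator (cball w (r / 2)) x \<partial>lborel)"
    using assms by (simp add: content_cball unit_ball_vol_2)
  also have "\<dots> \<le> (\<integral>x. bump 2 w r x \<partial>lborel)"
  proof (rule integral_mono')
    show "integrable lborel (bump 2 w r)"
      by (rule integrable_continuous_compact_support[OF continuous_on_bump compact_cball])
         (rule bump_eq_0[OF assms])
  qed (use bump_2_ge[OF assms] bump_nonneg in auto)
  finally show ?thesis .
qed

text \<open>By the mean value property, \<open>deriv f w\<close> times the mass of the bump is an
  integral bounded by a multiple of \<open>r powr (2 - 2 / p)\<close>. The mass is at least a
  multiple of \<open>r^2\<close>, and dividing leaves the stated power with a constant uniform in
  \<open>w\<close> and \<open>r\<close>.\<close>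

lemma L1p_deriv_bound:
  assumes f: "f holomorphic_on U" and U: "open U" and L: "f \<in> L1p_space p U" and "p > 1"
  obtains C where
    "\<And>w r. r > 0 \<Longrightarrow> cball w r \<subseteq> U \<Longrightarrow> norm (deriv f w) \<le> C * r powr (- (2 / p))"
proof -
  obtain v1 v2 where
    v1: "has_weak_gradient_on (\<lambda>x. f x \<bullet> 1) v1 U" "v1 \<in> Lp_space p U" and
    v2: "has_weak_gradient_on (\<lambda>x. f x \<bullet> \<i>) v2 U" "v2 \<in> Lp_space p U"
    using L by (auto simp: L1p_space_def Basis_complex_def)
  define N where "N v = (\<integral>x. norm (v x) powr p \<partial>lebesgue_on U)" for v :: "complex \<Rightarrow> complex"
  \<comment> \<open>The factor \<open>4 * exp 2 / (pi * r^2)\<close> inverts the lower bound for the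
    mass, the remaining 2 comes from the integral bound, and the bracket adds the contributions of
    the real and imaginary parts.\<close>
  define C where "C = 8 * exp 2 / pi * (2 * pi + N v1 + N v2)"
  have "norm (deriv f w) \<le> C * r powr (- (2 / p))" if r: "r > 0" "cball w r \<subseteq> U" for w r
  proof -
    define I where "I = (\<integral>x. deriv f x * complex_of_real (bump 2 w r x) \<partial>lborel)"
    have Ij: "\<bar>I \<bullet> j\<bar> \<le> 2 * r powr (2 - 2 / p) * (pi + N v)"
      if "has_weak_gradient_on (\<lambda>x. f x \<bullet> j) v U" "v \<in> Lp_space p U" for j v
      using Lp_bump_bound[OF that(2) U \<open>p > 1\<close> r(1), of 1 w] weak_gradient_bump[OF f U r that(1)]
      by (simp add: I_def N_def)
    have "norm (deriv f w) * (exp (- 2) * (pi * (r / 2)\<^sup>2)) \<le>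
        norm (deriv f w) * (\<integral>x. bump 2 w r x \<partial>lborel)"
      by (intro mult_left_mono bump_2_integral_ge r) auto
    also have "\<dots> = norm I"
      unfolding I_def holomorphic_bump_mean_value[OF holomorphic_deriv[OF f U] U r]
      by (simp add: norm_mult integral_nonneg bump_nonneg)
    also have "\<dots> \<le> \<bar>I \<bullet> 1\<bar> + \<bar>I \<bullet> \<i>\<bar>"
      using cmod_le[of I] by (simp add: inner_complex_def)
    also have "\<dots> \<le> 2 * r powr (2 - 2 / p) * (2 * pi + N v1 + N v2)"
      using Ij[OF v1] Ij[OF v2] by (simp add: algebra_simps)
    also have "r powr (2 - 2 / p) = r\<^sup>2 * r powr (- (2 / p))"
      using r by (simp add: powr_diff powr_minus field_simps)
    finally have "norm (deriv f w) * (exp (- 2) * (pi * (r / 2)\<^sup>2)) * (4 * exp 2 / (pi * r\<^sup>2)) \<le>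
        2 * (r\<^sup>2 * r powr (- (2 / p))) * (2 * pi + N v1 + N v2) * (4 * exp 2 / (pi * r\<^sup>2))"
      by (rule mult_right_mono) simp
    also have "norm (deriv f w) * (exp (- 2) * (pi * (r / 2)\<^sup>2)) * (4 * exp 2 / (pi * r\<^sup>2)) =
        norm (deriv f w)"
      using r by (simp add: exp_minus power_divide)
    also have "2 * (r\<^sup>2 * r powr (- (2 / p))) * (2 * pi + N v1 + N v2) * (4 * exp 2 / (pi * r\<^sup>2)) =
        C * r powr (- (2 / p))"
      using r by (simp add: C_def)
    finally show ?thesis .
  qed
  then show ?thesis
    by (rule that)
qed

section \<open>Lengths of images of radii\<close>

text \<open>Increments of \<open>V\<close> dominate those of \<open>g\<close>, and over any
  partition they telescope; \<open>V\<close> stands in for the integral of the speed.\<close>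

lemma path_length_le:
  assumes V: "\<And>s t. 0 \<le> s \<Longrightarrow> s \<le> t \<Longrightarrow> t \<le> 1 \<Longrightarrow> dist (g s) (g t) \<le> V t - V s"
  shows "path_length g \<le> ennreal (V 1 - V 0)"
  unfolding path_length_def
proof (rule SUP_least, clarify)
  fix n :: nat and t :: "nat \<Rightarrow> real"
  assume t: "mono_on {..n} t" "t 0 = 0" "t n = 1"
  have step: "dist (g (t k)) (g (t (Suc k))) \<le> V (t (Suc k)) - V (t k)" if "k < n" for k
  proof (rule V)
    show "0 \<le> t k" "t k \<le> t (Suc k)" "t (Suc k) \<le> 1"
      using mono_onD[OF t(1), of 0 k] mono_onD[OF t(1), of k "Suc k"]
        mono_onD[OF t(1), of "Suc k" n] t that by auto
  qed
  have "(\<Sum>k<n. ennreal (dist (g (t k)) (g (t (Suc k))))) =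
      ennreal (\<Sum>k<n. dist (g (t k)) (g (t (Suc k))))"
    by (rule sum_ennreal) simp
  also have "\<dots> \<le> ennreal (\<Sum>k<n. V (t (Suc k)) - V (t k))"
    using step by (intro ennreal_leI sum_mono) auto
  also have "\<dots> = ennreal (V 1 - V 0)"
    using t sum_lessThan_telescope[of "\<lambda>k. V (t k)" n] by simp
  finally show "(\<Sum>k<n. ennreal (dist (g (t k)) (g (t (Suc k))))) \<le> ennreal (V 1 - V 0)" .
qed

text \<open>A dominating function for the joined curve arises by running \<open>H\<close> backwards
  on the first half and forwards on the second.\<close>

lemma path_length_join_reversepath_le:
  assumes H: "\<And>s t. 0 \<le> s \<Longrightarrow> s \<le> t \<Longrightarrow> t \<le> 1 \<Longrightarrow> dist (p s) (p t) \<le> H t - H s"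
    "\<And>s t. 0 \<le> s \<Longrightarrow> s \<le> t \<Longrightarrow> t \<le> 1 \<Longrightarrow> dist (q s) (q t) \<le> H t - H s"
    and start: "pathstart p = pathstart q"
  shows "path_length (reversepath p +++ q) \<le> ennreal (2 * (H 1 - H 0))"
proof -
  \<comment> \<open>The shift by \<open>2 * H 0\<close> gives both branches the value
    \<open>- H 0\<close> at 1/2.\<close>
  define V where "V t = (if t \<le> 1 / 2 then - H (1 - 2 * t) else H (2 * t - 1) - 2 * H 0)" for t
  have "path_length (reversepath p +++ q) \<le> ennreal (V 1 - V 0)"
  proof (rule path_length_le)
    fix s t :: real
    assume st: "0 \<le> s" "s \<le> t" "t \<le> 1"
    let ?g = "reversepath p +++ q"
    consider "t \<le> 1 / 2" | "s \<le> 1 / 2" "t > 1 / 2" | "s > 1 / 2"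
      by linarith
    then show "dist (?g s) (?g t) \<le> V t - V s"
    proof cases
      case 1
      then show ?thesis
        using H(1)[of "1 - 2 * t" "1 - 2 * s"] st
        by (simp add: V_def joinpaths_def reversepath_def dist_commute)
    next
      case 2
      \<comment> \<open>The two parameters lie on different halves, so the estimate passes through
        the common starting point.\<close>
      have "dist (?g s) (?g t) = dist (p (1 - 2 * s)) (q (2 * t - 1))"
        using 2 by (simp add: joinpaths_def reversepath_def)
      also have "\<dots> \<le> dist (p (1 - 2 * s)) (p 0) + dist (p 0) (q (2 * t - 1))"
        by (rule dist_triangle)
      also have "dist (p 0) (q (2 * t - 1)) = dist (q 0) (q (2 * t - 1))"
        using start by (simp add: pathstart_def)
      also have "dist (p (1 - 2 * s)) (p 0) + dist (q 0) (q (2 * t - 1)) \<le> V t - V s"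
        using H(1)[of 0 "1 - 2 * s"] H(2)[of 0 "2 * t - 1"] 2 st
        by (simp add: V_def dist_commute)
      finally show ?thesis .
    next
      case 3
      then show ?thesis
        using H(2)[of "2 * s - 1" "2 * t - 1"] st by (simp add: V_def joinpaths_def)
    qed
  qed
  then show ?thesis
    by (simp add: V_def algebra_simps)
qed

text \<open>\<open>H\<close> is an antiderivative of \<open>C * ((1 - s) / 2) powr (- a)\<close>,
  which bounds the speed along the segment from 0 to \<open>z\<close>. The condition
  \<open>a < 1\<close> keeps \<open>H\<close> finite and continuous up to 1, and \<open>H\<close>
  does not depend on \<open>z\<close>.\<close>

lemma dist_radial_le:
  fixes f :: "complex \<Rightarrow> complex"
  assumes f: "f holomorphic_on ball 0 1" and a: "a < 1" and z: "z \<in> ball 0 1"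
    and bound: "\<And>w r. r > 0 \<Longrightarrow> cball w r \<subseteq> ball 0 1 \<Longrightarrow> norm (deriv f w) \<le> C * r powr (- a)"
    and st: "0 \<le> s" "s \<le> t" "t \<le> 1"
  defines "H \<equiv> \<lambda>s. - (C * 2 powr a / (1 - a) * (1 - s) powr (1 - a))"
  shows "dist (f (complex_of_real s * z)) (f (complex_of_real t * z)) \<le> H t - H s"
proof (cases "s = t")
  case False
  have in_ball: "complex_of_real x * z \<in> ball 0 1" if "0 \<le> x" "x \<le> 1" for x
    using z that mult_left_le_one_le[of "norm z" x] by (simp add: norm_mult)
  have "norm (f (complex_of_real t * z) - f (complex_of_real s * z)) \<le> H t - H s"
  proof (rule differentiable_bound_general)
    show "s < t"
      using st False by simp
    show "continuous_on {s..t} (\<lambda>x. f (complex_of_real x * z))"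
      using st in_ball
      by (intro continuous_on_compose2[OF holomorphic_on_imp_continuous_on[OF f]] continuous_intros)
         auto
    \<comment> \<open>At the endpoint 1, where \<open>H\<close> need not be differentiable,
      continuity is enough: derivatives are required only strictly between \<open>s\<close> and
      \<open>t\<close>.\<close>
    show "continuous_on {s..t} H"
      unfolding H_def using a st by (intro continuous_intros continuous_on_powr') auto
  next
    fix x
    assume x: "s < x" "x < t"
    have "(f has_field_derivative deriv f (complex_of_real x * z)) (at (complex_of_real x * z))"
      using x st in_ball[of x] by (intro holomorphic_derivI[OF f]) auto
    moreover have "((\<lambda>x. complex_of_real x * z) has_vector_derivative z) (at x)"
      by (auto intro!: derivative_eq_intros)
    ultimately show "((\<lambda>x. f (complex_of_real x * z)) has_vector_derivative
        z * deriv f (complex_of_real x * z)) (at x)"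
      using field_vector_diff_chain_at[of "\<lambda>x. complex_of_real x * z" z x f] by (simp add: o_def)
    have "((\<lambda>s. (1 - s) powr (1 - a)) has_real_derivative (1 - a) * (1 - x) powr (1 - a - 1) * (- 1)) (at x)"
      using x st by (intro DERIV_chain2[OF has_real_derivative_powr]) (auto intro!: derivative_eq_intros)
    from DERIV_minus[OF DERIV_cmult[OF this, of "C * 2 powr a / (1 - a)"]]
    have "(H has_real_derivative C * 2 powr a * (1 - x) powr (- a)) (at x)"
      using a by (simp add: H_def mult.assoc)
    also have "C * 2 powr a * (1 - x) powr (- a) = C * ((1 - x) / 2) powr (- a)"
      using x st by (simp add: powr_divide powr_minus divide_simps)
    finally have "(H has_real_derivative C * ((1 - x) / 2) powr (- a)) (at x)" .
    then show "(H has_vector_derivative C * ((1 - x) / 2) powr (- a)) (at x)"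
      by (simp add: has_real_derivative_iff_has_vector_derivative)
    \<comment> \<open>The centre has norm at most \<open>x\<close>, so half of \<open>1 - x\<close>
      is a radius for which even the closed disc stays inside the open unit disc.\<close>
    have "cball (complex_of_real x * z) ((1 - x) / 2) \<subseteq> ball 0 1"
    proof
      fix y
      assume y: "y \<in> cball (complex_of_real x * z) ((1 - x) / 2)"
      have "norm (complex_of_real x * z) \<le> x"
        using z x st by (simp add: norm_mult mult_left_le)
      moreover have "norm y \<le> norm (complex_of_real x * z) + dist (complex_of_real x * z) y"
        by (metis dist_commute dist_norm norm_triangle_sub)
      ultimately show "y \<in> ball 0 1"
        using y x st by (auto simp: field_simps)
    qed
    then have b: "norm (deriv f (complex_of_real x * z)) \<le> C * ((1 - x) / 2) powr (- a)"
      using x st by (intro bound) auto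
    have "norm (z * deriv f (complex_of_real x * z)) \<le> norm (deriv f (complex_of_real x * z))"
      using z by (simp add: norm_mult mult_left_le_one_le)
    with b show "norm (z * deriv f (complex_of_real x * z)) \<le> C * ((1 - x) / 2) powr (- a)"
      by linarith
  qed
  then show ?thesis
    by (simp add: dist_norm norm_minus_commute)
qed simp

text \<open>Two image points \<open>f a\<close> and \<open>f b\<close> are joined by following the
  image of the segment from \<open>a\<close> to 0 and then that of the segment from 0 to
  \<open>b\<close>. Each half has length at most \<open>H 1 - H 0\<close>, uniformly in
  \<open>a\<close> and \<open>b\<close>.\<close>

lemma L1p_geodesic_diameter_finite:
  fixes f :: "complex \<Rightarrow> complex"
  assumes f: "f holomorphic_on ball 0 1" and L: "f \<in> L1p_space p (ball 0 1)" and p: "p > 2"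
  shows "geodesic_diameter (f ` ball 0 1) < \<infinity>"
proof -
  from p have "p > 1"
    by simp
  from L1p_deriv_bound[OF f open_ball L this]
  obtain C where C: "\<And>w r. r > 0 \<Longrightarrow> cball w r \<subseteq> ball 0 1 \<Longrightarrow>
      norm (deriv f w) \<le> C * r powr (- (2 / p))"
    by blast
  \<comment> \<open>This is where \<open>p > 2\<close> is decisive: the bound on the derivative
    becomes integrable along radii.\<close>
  have a: "2 / p < 1"
    using p by simp
  define H where "H s = - (C * 2 powr (2 / p) / (1 - 2 / p) * (1 - s) powr (1 - 2 / p))" for s
  define ray where "ray z t = f (complex_of_real t * z)" for z t
  have ray: "dist (ray z s) (ray z t) \<le> H t - H s"
    if "z \<in> ball 0 1" "0 \<le> s" "s \<le> t" "t \<le> 1" for z s t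
    unfolding ray_def H_def using dist_radial_le[OF f a that(1) C that(2-4)] .
  have "geodesic_distance (f ` ball 0 1) (f a) (f b) \<le> ennreal (2 * (H 1 - H 0))"
    if ab: "a \<in> ball 0 1" "b \<in> ball 0 1" for a b
    unfolding geodesic_distance_def
  proof (rule INF_lower2)
    let ?g = "reversepath (ray a) +++ ray b"
    have start: "pathstart (ray a) = pathstart (ray b)"
      by (simp add: pathstart_def ray_def)
    have in_ball: "complex_of_real x * z \<in> ball 0 1" if "z \<in> ball 0 1" "0 \<le> x" "x \<le> 1" for x z
      using that mult_left_le_one_le[of "norm z" x] by (simp add: norm_mult)
    have path: "path (ray z)" "path_image (ray z) \<subseteq> f ` ball 0 1" if "z \<in> ball 0 1" for z
    proof -
      show "path (ray z)"
        unfolding path_def ray_def using in_ball[OF that]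
        by (intro continuous_on_compose2[OF holomorphic_on_imp_continuous_on[OF f]] continuous_intros)
           auto
      show "path_image (ray z) \<subseteq> f ` ball 0 1"
        using in_ball[OF that] unfolding path_image_def ray_def by (auto intro!: imageI)
    qed
    show "path_length ?g \<le> ennreal (2 * (H 1 - H 0))"
      by (rule path_length_join_reversepath_le[OF ray[OF ab(1)] ray[OF ab(2)] start])
    have "path_image ?g \<subseteq> f ` ball 0 1"
      using path[OF ab(1)] path[OF ab(2)] start by (simp add: path_image_join)
    moreover have "pathfinish (ray z) = f z" for z
      by (simp add: pathfinish_def ray_def)
    ultimately show "?g \<in> {g. path g \<and> path_image g \<subseteq> f ` ball 0 1 \<and>
        pathstart g = f a \<and> pathfinish g = f b}"
      using path[OF ab(1)] path[OF ab(2)] start by simp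
  qed
  then have "geodesic_diameter (f ` ball 0 1) \<le> ennreal (2 * (H 1 - H 0))"
    unfolding geodesic_diameter_def by (intro SUP_least) auto
  also have "\<dots> < \<infinity>"
    by simp
  finally show ?thesis .
qed

theorem theoremC:
  fixes D :: "complex set"
  assumes "open D" and "connected D" and "D \<noteq> {}"
    and "bounded D"
    and "simply_connected D"
    and "geodesic_diameter D = \<infinity>"
  shows "\<forall>\<epsilon>::real. \<epsilon> > 0 \<longrightarrow>
           \<not> (\<exists>\<phi>. conformal_map_onto \<phi> (ball 0 1) D \<and> \<phi> \<in> L1p_space (2 + \<epsilon>) (ball 0 1))"
proof (intro allI impI notI)
  fix \<epsilon> :: real
  assume "\<epsilon> > 0" "\<exists>\<phi>. conformal_map_onto \<phi> (ball 0 1) D \<and> \<phi> \<in> L1p_space (2 + \<epsilon>) (ball 0 1)"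
  then obtain \<phi> where "\<phi> holomorphic_on ball 0 1" "\<phi> ` ball 0 1 = D"
      "\<phi> \<in> L1p_space (2 + \<epsilon>) (ball 0 1)"
    by (auto simp: conformal_map_onto_def)
  with L1p_geodesic_diameter_finite[of \<phi> "2 + \<epsilon>"] \<open>\<epsilon> > 0\<close> assms(6) show False
    by simp
qed

end
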